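(* Let $D\subset\mathbb{R}^m$ and $E\subset\mathbb{R}^r$ be compact sets with Lipschitz boundaries. The conditioning operators admit unique continuous extensions to $\mathcal{X}_+$ and $\mathcal{X}_+\times E$, respectively. That is, there exist a unique continuous map $\widetilde{\mathcal{G}}^\star:\mathcal{X}_+\to C(D\times E)$ with $\widetilde{\mathcal{G}}^\star|_{\mathcal{X}_\delta}=\mathcal{G}^\star_\delta$ for every $\delta>0$, and a unique continuous map $\widetilde{\Psi}^\star:\mathcal{X}_+\times E\to C(D)$ with $\widetilde{\Psi}^\star|_{\mathcal{X}_\delta\times E}=\Psi^\star_\delta$ for every $\delta>0$.
   Context: $C(\cdot)$ carries the supremum norm. $C_{\mathrm{ac}}(D\times E)$ is the set of $\rho\in C(D\times E)$ with $\rho\ge0$ and $\int_{D\times E}\rho(z)\,dz=1$. For such $\rho$, $m_\rho(y)=\int_D\rho(x,y)\,dx$ for $y\in E$. For $\delta>0$, $\mathcal{X}_\delta=\{\rho\in C_{\mathrm{ac}}(D\times E):\inf_{y\in E}m_\rho(y)\ge\delta\}$, and $\mathcal{X}_+=\bigcup_{\delta>0}\mathcal{X}_\delta$, with the supremum-norm metric; $\mathcal{X}_+\times E$ has the metric induced by $\max(\|\rho\|_{C(D\times E)},\|y\|)$. For $\delta>0$, the kernel conditioning operator is $\mathcal{G}^\star_\delta:\mathcal{X}_\delta\to C(D\times E)$, $\mathcal{G}^\star_\delta(\rho)(x,y)=\rho(x,y)/m_\rho(y)$, and the in-context conditioning operator is $\Psi^\star_\delta:\mathcal{X}_\delta\times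 E\to C(D)$, $\Psi^\star_\delta(\rho,y)(x)=\rho(x,y)/m_\rho(y)$. *)

theory Defs
  imports "HOL-Analysis.Analysis"
begin

text \<open>
  Near every boundary point the set is, in the orthonormal frame given by a unit vector \<open>u\<close>,
  the set of points on or above the graph of a Lipschitz function \<open>g\<close> over the hyperplane
  orthogonal to \<open>u\<close>; the projection of \<open>x\<close> to this hyperplane is \<open>x - (x \<bullet> u) *\<^sub>R u\<close>.
\<close>

definition lipschitz_boundary :: "'a::euclidean_space set \<Rightarrow> bool" where
  "lipschitz_boundary S \<longleftrightarrow>
     (\<forall>p \<in> frontier S. \<exists>U u g L.
        open U \<and> p \<in> U \<and> norm u = 1 \<and> L-lipschitz_on {v. v \<bullet> u = 0} (g :: 'a \<Rightarrow> real) \<and>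
        S \<inter> U = {x \<in> U. g (x - (x \<bullet> u) *\<^sub>R u) \<le> x \<bullet> u})"

text \<open>
  The space \<open>C(K)\<close> with the supremum metric, for compact \<open>K\<close>. Its elements are represented by
  functions that are \<^const>\<open>undefined\<close> outside \<open>K\<close>, so that equality is equality on \<open>K\<close>.
\<close>

definition C_space :: "'a::topological_space set \<Rightarrow> ('a \<Rightarrow> real) metric" where
  "C_space K = cfunspace (top_of_set K) euclidean_metric"

lemma mspace_C_space:
  assumes "compact K"
  shows "mspace (C_space K) = {f \<in> extensional K. continuous_on K f}"
  using assms
  by (auto simp: C_space_def compactin_mspace_cfunspace compactin_subtopology
      simp del: mspace_cfunspace)

lemma mdist_C_space:
  assumes "f \<in> mspace (C_space K)" "g \<in> mspace (C_space K)" "K \<noteq> {}"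
  shows "mdist (C_space K) f g = (SUP x\<in>K. \<bar>f x - g x\<bar>)"
  using assms
  by (auto simp: C_space_def mdist_cfunspace_eq_mdist_funspace Met_TC.fdist_def Met_TC.fspace_def
      dist_real_def)

definition C_ac :: "'a::euclidean_space set \<Rightarrow> 'b::euclidean_space set \<Rightarrow> ('a \<times> 'b \<Rightarrow> real) set" where
  "C_ac D E = {\<rho> \<in> mspace (C_space (D \<times> E)).
     (\<forall>z \<in> D \<times> E. 0 \<le> \<rho> z) \<and> (LINT z:D \<times> E|lborel. \<rho> z) = 1}"

definition marginal :: "'a::euclidean_space set \<Rightarrow> ('a \<times> 'b \<Rightarrow> real) \<Rightarrow> 'b \<Rightarrow> real" where
  "marginal D \<rho> y = (LINT x:D|lborel. \<rho> (x, y))"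

definition X_delta ::
  "'a::euclidean_space set \<Rightarrow> 'b::euclidean_space set \<Rightarrow> real \<Rightarrow> ('a \<times> 'b \<Rightarrow> real) set" where
  "X_delta D E \<delta> = {\<rho> \<in> C_ac D E. \<delta> \<le> (INF y\<in>E. marginal D \<rho> y)}"

definition X_plus ::
  "'a::euclidean_space set \<Rightarrow> 'b::euclidean_space set \<Rightarrow> ('a \<times> 'b \<Rightarrow> real) set" where
  "X_plus D E = (\<Union>\<delta>\<in>{0<..}. X_delta D E \<delta>)"

definition X_plus_metric ::
  "'a::euclidean_space set \<Rightarrow> 'b::euclidean_space set \<Rightarrow> ('a \<times> 'b \<Rightarrow> real) metric" where
  "X_plus_metric D E = submetric (C_space (D \<times> E)) (X_plus D E)"

lemma mspace_X_plus_metric: "mspace (X_plus_metric D E) = X_plus D E"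
  by (auto simp: X_plus_metric_def X_plus_def X_delta_def C_ac_def)

text \<open>The library's \<^const>\<open>prod_metric\<close> is the Euclidean product metric, not the maximum.\<close>

definition max_metric :: "'a metric \<Rightarrow> 'b metric \<Rightarrow> ('a \<times> 'b) metric" where
  "max_metric m1 m2 =
     metric (mspace m1 \<times> mspace m2, \<lambda>p q. max (mdist m1 (fst p) (fst q)) (mdist m2 (snd p) (snd q)))"

lemma Metric_space_max:
  "Metric_space (mspace m1 \<times> mspace m2)
     (\<lambda>p q. max (mdist m1 (fst p) (fst q)) (mdist m2 (snd p) (snd q)))"
proof
  fix x y z
  assume "x \<in> mspace m1 \<times> mspace m2" "y \<in> mspace m1 \<times> mspace m2" "z \<in> mspace m1 \<times> mspace m2"
  then have "mdist m1 (fst x) (fst z) \<le> mdist m1 (fst x) (fst y) + mdist m1 (fst y) (fst z)"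
    "mdist m2 (snd x) (snd z) \<le> mdist m2 (snd x) (snd y) + mdist m2 (snd y) (snd z)"
    by (auto intro!: mdist_triangle)
  then show "max (mdist m1 (fst x) (fst z)) (mdist m2 (snd x) (snd z))
      \<le> max (mdist m1 (fst x) (fst y)) (mdist m2 (snd x) (snd y))
        + max (mdist m1 (fst y) (fst z)) (mdist m2 (snd y) (snd z))"
    by linarith
next
  fix x y
  assume xy: "x \<in> mspace m1 \<times> mspace m2" "y \<in> mspace m1 \<times> mspace m2"
  have "max (mdist m1 (fst x) (fst y)) (mdist m2 (snd x) (snd y)) = 0 \<longleftrightarrow>
      mdist m1 (fst x) (fst y) = 0 \<and> mdist m2 (snd x) (snd y) = 0"
    using mdist_nonneg[of m1 "fst x" "fst y"] mdist_nonneg[of m2 "snd x" "snd y"] by linarith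
  also have "\<dots> \<longleftrightarrow> x = y"
    using xy by (auto simp: prod_eq_iff mem_Times_iff)
  finally show "max (mdist m1 (fst x) (fst y)) (mdist m2 (snd x) (snd y)) = 0 \<longleftrightarrow> x = y" .
qed (auto simp: mdist_commute le_max_iff_disj)

lemma mspace_max_metric [simp]: "mspace (max_metric m1 m2) = mspace m1 \<times> mspace m2"
  by (simp add: max_metric_def Metric_space.mspace_metric[OF Metric_space_max])

lemma mdist_max_metric [simp]:
  "mdist (max_metric m1 m2) p q = max (mdist m1 (fst p) (fst q)) (mdist m2 (snd p) (snd q))"
  by (simp add: max_metric_def Metric_space.mdist_metric[OF Metric_space_max])

text \<open>
  The domain of a map on a subset of a type is recorded by extensionality. Thus the parameter
  \<open>\<delta>\<close> in the following two operators only determines their domain.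
\<close>

definition kernel_conditioning ::
  "'a::euclidean_space set \<Rightarrow> 'b::euclidean_space set \<Rightarrow> real \<Rightarrow>
     ('a \<times> 'b \<Rightarrow> real) \<Rightarrow> ('a \<times> 'b \<Rightarrow> real)" where
  "kernel_conditioning D E \<delta> =
     (\<lambda>\<rho> \<in> X_delta D E \<delta>. \<lambda>z \<in> D \<times> E. \<rho> z / marginal D \<rho> (snd z))"

definition in_context_conditioning ::
  "'a::euclidean_space set \<Rightarrow> 'b::euclidean_space set \<Rightarrow> real \<Rightarrow>
     ('a \<times> 'b \<Rightarrow> real) \<times> 'b \<Rightarrow> ('a \<Rightarrow> real)" where
  "in_context_conditioning D E \<delta> =
     (\<lambda>p \<in> X_delta D E \<delta> \<times> E. \<lambda>x \<in> D. fst p (x, snd p) / marginal D (fst p) (snd p))"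

end

theory Submission
  imports Defs
begin

text \<open>
  On \<open>X_plus\<close> the extensions are forced to be given by the same quotient formula, so only their
  continuity is at stake. If \<open>\<sigma>\<close> tends to \<open>\<rho>\<close> uniformly, then so do the marginals, since \<open>D\<close> has
  finite measure; as the marginal of \<open>\<rho>\<close> is bounded away from zero, the quotients converge
  uniformly. In-context conditioning is kernel conditioning followed by
  \<open>(f, y) \<mapsto> f (\<cdot>, y)\<close>, which is jointly continuous because \<open>f\<close> is uniformly continuous.
\<close>

section \<open>Convergence in \<open>C_space K\<close> and evaluation of slices\<close>

text \<open>Translates the abstract topology into \<open>uniform_limit\<close>, so that the
  continuity proofs can use the calculus of uniform limits. A bound on the supremum bounds every
  point; conversely, pointwise bounds by \<open>e\<close> bound the supremum by \<open>e\<close>,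
  though no longer strictly.\<close>

lemma limitin_C_space:
  assumes "compact K"
  shows "limitin (mtopology_of (C_space K)) f l F \<longleftrightarrow>
    l \<in> mspace (C_space K) \<and> (\<forall>\<^sub>F i in F. f i \<in> mspace (C_space K)) \<and> uniform_limit K f l F"
proof -
  have bdd: "bdd_above ((\<lambda>x. \<bar>g x - h x\<bar>) ` K)"
    if "g \<in> mspace (C_space K)" "h \<in> mspace (C_space K)" for g h
  proof -
    have "continuous_on K (\<lambda>x. \<bar>g x - h x\<bar>)"
      using that assms by (intro continuous_intros) (auto simp: mspace_C_space)
    then show ?thesis
      using assms by (intro bounded_imp_bdd_above compact_imp_bounded compact_continuous_image)
  qed
  have lt: "\<bar>g x - h x\<bar> < e"
    if "g \<in> mspace (C_space K)" "h \<in> mspace (C_space K)" "mdist (C_space K) g h < e" "x \<in> K"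
    for g h e x
  proof -
    have "\<bar>g x - h x\<bar> \<le> (SUP x\<in>K. \<bar>g x - h x\<bar>)"
      using bdd that by (intro cSUP_upper)
    then show ?thesis
      using that mdist_C_space[of g K h] by fastforce
  qed
  have le: "mdist (C_space K) g h \<le> e"
    if "g \<in> mspace (C_space K)" "h \<in> mspace (C_space K)" "\<And>x. x \<in> K \<Longrightarrow> \<bar>g x - h x\<bar> < e" "0 < e"
    for g h e
  proof (cases "K = {}")
    \<comment> \<open>The supremum formula for the distance is only available for nonempty
      \<open>K\<close>; here, however, extensionality leaves a single function.\<close>
    case True
    then have "g = h"
      using that assms by (auto simp: mspace_C_space)
    then show ?thesis
      using that by (simp add: Metric_space.mdist_zero[OF Metric_space_mspace_mdist])
  next
    case False
    have "(SUP x\<in>K. \<bar>g x - h x\<bar>) \<le> e"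
      using False that(3) by (intro cSUP_least less_imp_le)
    then show ?thesis
      using mdist_C_space[OF that(1,2) False] by simp
  qed
  have "(\<forall>e>0. \<forall>\<^sub>F i in F. f i \<in> mspace (C_space K) \<and> mdist (C_space K) (f i) l < e) \<longleftrightarrow>
    (\<forall>\<^sub>F i in F. f i \<in> mspace (C_space K)) \<and> uniform_limit K f l F" (is "?L \<longleftrightarrow> ?R")
    if l: "l \<in> mspace (C_space K)"
  proof
    assume L: ?L
    have "uniform_limit K f l F"
    proof (rule uniform_limitI)
      fix e :: real assume "0 < e"
      with L have "\<forall>\<^sub>F i in F. f i \<in> mspace (C_space K) \<and> mdist (C_space K) (f i) l < e"
        by blast
      then show "\<forall>\<^sub>F i in F. \<forall>x\<in>K. dist (f i x) (l x) < e"
        by eventually_elim (use l lt in \<open>auto simp: dist_real_def\<close>)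
    qed
    moreover have "\<forall>\<^sub>F i in F. f i \<in> mspace (C_space K)"
      using L[rule_format, of 1] by (auto elim: eventually_mono)
    ultimately show ?R by blast
  next
    assume R: ?R
    show ?L
    proof (intro allI impI)
      fix e :: real assume "0 < e"
      \<comment> \<open>Half of \<open>e\<close>, because \<open>le\<close> yields only a weak
        inequality and a strict one is wanted.\<close>
      then have "\<forall>\<^sub>F i in F. \<forall>x\<in>K. dist (f i x) (l x) < e / 2"
        using R by (auto dest!: uniform_limitD[where e = "e / 2"])
      with R[THEN conjunct1]
      show "\<forall>\<^sub>F i in F. f i \<in> mspace (C_space K) \<and> mdist (C_space K) (f i) l < e"
      proof eventually_elim
        case (elim i)
        then have "mdist (C_space K) (f i) l \<le> e / 2"
          using l \<open>0 < e\<close> by (intro le) (auto simp: dist_real_def)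
        then show ?case
          using elim \<open>0 < e\<close> by simp
      qed
    qed
  qed
  then show ?thesis
    unfolding mtopology_of_def
    by (subst Metric_space.limitin_metric[OF Metric_space_mspace_mdist]) blast
qed

lemma continuous_on_slice:
  assumes "continuous_on (D \<times> E) f" "y \<in> E"
  shows "continuous_on D (\<lambda>x. f (x, y))"
  by (rule continuous_on_compose2[OF assms(1)]) (use assms(2) in \<open>auto intro!: continuous_intros\<close>)

text \<open>Moving from \<open>f (x, y)\<close> to \<open>g (x, y')\<close> passes through
  \<open>f (x, y')\<close>: uniform closeness of \<open>g\<close> to \<open>f\<close> controls one
  part, uniform continuity of \<open>f\<close> on the compact product the other.\<close>

lemma continuous_map_slice:
  fixes D :: "'a::metric_space set" and E :: "'b::metric_space set"
  assumes "compact D" "compact E"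
  shows "continuous_map (prod_topology (mtopology_of (C_space (D \<times> E))) (top_of_set E))
    (mtopology_of (C_space D)) (\<lambda>(f, y). \<lambda>x\<in>D. f (x, y))"
    (is "continuous_map ?X ?Y ?ev")
  unfolding continuous_map_atin
proof
  have DE: "compact (D \<times> E)"
    using assms by (rule compact_Times)
  have ev_C: "?ev p \<in> mspace (C_space D)" if "p \<in> topspace ?X" for p
  proof -
    obtain f y where fy: "p = (f, y)" "continuous_on (D \<times> E) f" "y \<in> E"
      using \<open>p \<in> topspace ?X\<close> DE by (cases p) (auto simp: mspace_C_space)
    then have "continuous_on D (\<lambda>x\<in>D. f (x, y))"
      using continuous_on_slice[of D E f y] by (simp cong: continuous_on_cong)
    then show ?thesis
      using assms fy by (simp add: mspace_C_space)
  qed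
  fix p assume p: "p \<in> topspace ?X"
  let ?F = "atin ?X p"
  obtain f y where fy: "p = (f, y)" "continuous_on (D \<times> E) f" "y \<in> E"
    using p DE by (cases p) (auto simp: mspace_C_space)
  have "limitin (mtopology_of (C_space (D \<times> E))) fst f ?F"
    using p fy by (intro limitin_continuous_map[OF continuous_map_fst]) simp_all
  then have lim_fst: "uniform_limit (D \<times> E) fst f ?F"
    using DE by (simp add: limitin_C_space)
  \<comment> \<open>The subspace topology also keeps \<open>snd q\<close> in \<open>E\<close>
    eventually, so that the uniform bounds on \<open>D \<times> E\<close> apply at
    \<open>(x, snd q)\<close>.\<close>
  have "limitin (top_of_set E) snd y ?F"
    using p fy by (intro limitin_continuous_map[OF continuous_map_snd]) simp_all
  then have lim_snd: "(snd \<longlongrightarrow> y) ?F" "\<forall>\<^sub>F q in ?F. snd q \<in> E"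
    by (auto simp: limitin_subtopology)
  have "uniform_limit D ?ev (?ev p) ?F"
  proof (rule uniform_limitI)
    fix e :: real assume "0 < e"
    have "uniformly_continuous_on (D \<times> E) f"
      using fy DE by (intro compact_uniformly_continuous)
    then obtain d where "0 < d" and d: "\<And>z z'. \<lbrakk>z \<in> D \<times> E; z' \<in> D \<times> E; dist z' z < d\<rbrakk> \<Longrightarrow>
        dist (f z') (f z) < e / 2"
      using \<open>0 < e\<close> unfolding uniformly_continuous_on_def by (meson half_gt_zero)
    have "\<forall>\<^sub>F q in ?F. \<forall>z\<in>D \<times> E. dist (fst q z) (f z) < e / 2"
      using lim_fst \<open>0 < e\<close> by (auto dest!: uniform_limitD[where e = "e / 2"])
    with lim_snd(2) tendstoD[OF lim_snd(1) \<open>0 < d\<close>]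
    show "\<forall>\<^sub>F q in ?F. \<forall>x\<in>D. dist (?ev q x) (?ev p x) < e"
    proof eventually_elim
      case (elim q)
      show ?case
      proof
        fix x assume "x \<in> D"
        then have "dist (fst q (x, snd q)) (f (x, snd q)) < e / 2"
          using elim by auto
        moreover have "dist (f (x, snd q)) (f (x, y)) < e / 2"
          using elim fy \<open>x \<in> D\<close> by (intro d) (auto simp: dist_Pair_Pair)
        ultimately have "dist (fst q (x, snd q)) (f (x, y)) < e"
          using dist_triangle[of "fst q (x, snd q)" "f (x, y)" "f (x, snd q)"] by linarith
        then show "dist (?ev q x) (?ev p x) < e"
          using \<open>x \<in> D\<close> fy by (simp add: case_prod_beta)
      qed
    qed
  qed
  \<comment> \<open>Membership holds on the entire space, which therefore serves as the open
    neighbourhood of \<open>p\<close>.\<close>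
  moreover have "\<forall>\<^sub>F q in ?F. ?ev q \<in> mspace (C_space D)"
    using p ev_C unfolding eventually_atin by (intro disjI2 exI[of _ "topspace ?X"]) blast
  ultimately show "limitin ?Y ?ev (?ev p) ?F"
    using assms p ev_C by (simp add: limitin_C_space)
qed

section \<open>Continuity and convergence of marginals\<close>

text \<open>Integrates the pointwise bound; compactness of \<open>D\<close> makes its measure finite
  and continuous functions integrable on it.\<close>

lemma abs_set_lebesgue_integral_diff_le:
  fixes f g :: "'a::euclidean_space \<Rightarrow> real"
  assumes "compact D" "continuous_on D f" "continuous_on D g"
    and "\<And>x. x \<in> D \<Longrightarrow> \<bar>f x - g x\<bar> \<le> e"
  shows "\<bar>(LINT x:D|lborel. f x) - (LINT x:D|lborel. g x)\<bar> \<le> measure lborel D * e"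
proof -
  have int: "set_integrable lborel D h" if "continuous_on D h" for h :: "'a \<Rightarrow> real"
    unfolding set_integrable_def using \<open>compact D\<close> that by (rule borel_integrable_compact)
  have "\<bar>LINT x:D|lborel. f x - g x\<bar> \<le> (LINT x:D|lborel. e)"
    unfolding set_lebesgue_integral_def
  proof (rule integral_abs_bound_integral)
    show "integrable lborel (\<lambda>x. indicator D x *\<^sub>R (f x - g x))"
      "integrable lborel (\<lambda>x. indicator D x *\<^sub>R e)"
      using assms int[of "\<lambda>x. f x - g x"] int[of "\<lambda>x. e"]
      by (auto simp: set_integrable_def continuous_on_diff)
  qed (use assms in \<open>auto simp: indicator_def\<close>)
  moreover have "(LINT x:D|lborel. e) = measure lborel D * e"
    using emeasure_compact_finite[OF \<open>compact D\<close>] \<open>compact D\<close>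
    by (subst set_integral_const) (auto simp: borel_compact)
  ultimately show ?thesis
    using assms by (simp add: int)
qed

text \<open>Uniform continuity of \<open>\<rho>\<close> makes the slices at nearby \<open>y\<close>
  and \<open>y'\<close> uniformly close on \<open>D\<close>, hence also their integrals.\<close>

lemma continuous_on_marginal:
  fixes D :: "'a::euclidean_space set" and E :: "'b::metric_space set"
  assumes "compact D" "compact E" "continuous_on (D \<times> E) \<rho>"
  shows "continuous_on E (marginal D \<rho>)"
  unfolding continuous_on_iff
proof (intro ballI allI impI)
  fix y and e :: real assume "y \<in> E" "0 < e"
  \<comment> \<open>The added 1 keeps the divisor positive even if \<open>D\<close> is a null set,
    and makes \<open>measure lborel D * (e / V)\<close> strictly less than \<open>e\<close>.\<close>
  define V where "V = measure lborel D + 1"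
  have "0 < V"
    by (simp add: V_def add_nonneg_pos)
  have "uniformly_continuous_on (D \<times> E) \<rho>"
    using assms by (intro compact_uniformly_continuous compact_Times)
  then obtain d where "0 < d" and d: "\<And>z z'. \<lbrakk>z \<in> D \<times> E; z' \<in> D \<times> E; dist z' z < d\<rbrakk> \<Longrightarrow>
      dist (\<rho> z') (\<rho> z) < e / V"
    using divide_pos_pos[OF \<open>0 < e\<close> \<open>0 < V\<close>] unfolding uniformly_continuous_on_def by metis
  have "dist (marginal D \<rho> y') (marginal D \<rho> y) < e" if "y' \<in> E" "dist y' y < d" for y'
  proof -
    have "\<bar>marginal D \<rho> y' - marginal D \<rho> y\<bar> \<le> measure lborel D * (e / V)"
      unfolding marginal_def
    proof (intro abs_set_lebesgue_integral_diff_le)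
      fix x assume "x \<in> D"
      then show "\<bar>\<rho> (x, y') - \<rho> (x, y)\<bar> \<le> e / V"
        using d[of "(x, y)" "(x, y')"] that \<open>y \<in> E\<close> by (auto simp: dist_Pair_Pair dist_real_def)
    qed (use assms that \<open>y \<in> E\<close> in \<open>auto intro: continuous_on_slice\<close>)
    also have "\<dots> < V * (e / V)"
      using \<open>0 < e\<close> \<open>0 < V\<close> by (intro mult_strict_right_mono) (auto simp: V_def)
    finally show ?thesis
      using \<open>0 < V\<close> by (simp add: dist_real_def)
  qed
  then show "\<exists>d>0. \<forall>y'\<in>E. dist y' y < d \<longrightarrow> dist (marginal D \<rho> y') (marginal D \<rho> y) < e"
    using \<open>0 < d\<close> by blast
qed

text \<open>The integral estimate is applied to the slices of \<open>f i\<close> and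
  \<open>l\<close> at the same \<open>y\<close>; its bound does not depend on
  \<open>y\<close>.\<close>

lemma uniform_limit_marginal:
  assumes "compact D" "uniform_limit (D \<times> E) f l F"
    and "\<forall>\<^sub>F i in F. continuous_on (D \<times> E) (f i)" "continuous_on (D \<times> E) l"
  shows "uniform_limit E (\<lambda>i. marginal D (f i)) (marginal D l) F"
proof (rule uniform_limitI)
  fix e :: real assume "0 < e"
  define V where "V = measure lborel D + 1"
  have "0 < V"
    by (simp add: V_def add_nonneg_pos)
  have "\<forall>\<^sub>F i in F. \<forall>z\<in>D \<times> E. dist (f i z) (l z) < e / V"
    using assms(2) \<open>0 < e\<close> \<open>0 < V\<close> by (auto dest!: uniform_limitD[where e = "e / V"])
  with assms(3) show "\<forall>\<^sub>F i in F. \<forall>y\<in>E. dist (marginal D (f i) y) (marginal D l y) < e"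
  proof eventually_elim
    case (elim i)
    show ?case
    proof
      fix y assume "y \<in> E"
      have "\<bar>marginal D (f i) y - marginal D l y\<bar> \<le> measure lborel D * (e / V)"
        unfolding marginal_def
        by (intro abs_set_lebesgue_integral_diff_le)
          (use assms elim \<open>y \<in> E\<close> in
            \<open>auto intro: continuous_on_slice less_imp_le simp flip: dist_real_def\<close>)
      also have "\<dots> < V * (e / V)"
        using \<open>0 < e\<close> \<open>0 < V\<close> by (intro mult_strict_right_mono) (auto simp: V_def)
      finally show "dist (marginal D (f i) y) (marginal D l y) < e"
        using \<open>0 < V\<close> by (simp add: dist_real_def)
    qed
  qed
qed

text \<open>Turns the condition on the infimum into a pointwise lower bound. A real
  \<open>INF\<close> is a lower bound only for a set bounded below, which the continuity of the
  marginal on compact \<open>E\<close> guarantees.\<close>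

lemma X_plus_cases:
  assumes "compact D" "compact E" "\<rho> \<in> X_plus D E"
  obtains \<delta> where "0 < \<delta>" "\<And>y. y \<in> E \<Longrightarrow> \<delta> \<le> marginal D \<rho> y" "continuous_on (D \<times> E) \<rho>"
proof -
  obtain \<delta> where \<delta>: "0 < \<delta>" "\<rho> \<in> X_delta D E \<delta>"
    using assms by (auto simp: X_plus_def)
  then have cont: "continuous_on (D \<times> E) \<rho>"
    using assms by (auto simp: X_delta_def C_ac_def mspace_C_space compact_Times)
  have "bdd_below (marginal D \<rho> ` E)"
    using assms cont
    by (intro bounded_imp_bdd_below compact_imp_bounded compact_continuous_image
        continuous_on_marginal)
  then have "(INF y\<in>E. marginal D \<rho> y) \<le> marginal D \<rho> y" if "y \<in> E" for y
    using that by (rule cINF_lower)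
  then show thesis
    using \<delta> cont by (intro that[of \<delta>]) (force simp: X_delta_def)+
qed

section \<open>Continuity of the conditioning operators\<close>

text \<open>The formula shared by all \<open>kernel_conditioning D E \<delta>\<close>, with no
  restriction on \<open>\<rho>\<close>; the domain is cut down only when the extension is
  formed.\<close>

definition conditional_kernel ::
  "'a::euclidean_space set \<Rightarrow> 'b::euclidean_space set \<Rightarrow> ('a \<times> 'b \<Rightarrow> real) \<Rightarrow> ('a \<times> 'b \<Rightarrow> real)" where
  "conditional_kernel D E \<rho> = (\<lambda>z\<in>D \<times> E. \<rho> z / marginal D \<rho> (snd z))"

lemma continuous_map_conditional_kernel:
  assumes "compact D" "compact E"
  shows "continuous_map (mtopology_of (X_plus_metric D E)) (mtopology_of (C_space (D \<times> E)))
    (conditional_kernel D E)"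
  unfolding continuous_map_atin
proof
  have DE: "compact (D \<times> E)"
    using assms by (rule compact_Times)
  have in_C: "conditional_kernel D E \<rho> \<in> mspace (C_space (D \<times> E))" if "\<rho> \<in> X_plus D E" for \<rho>
  proof -
    obtain \<delta> where \<delta>: "0 < \<delta>" "\<And>y. y \<in> E \<Longrightarrow> \<delta> \<le> marginal D \<rho> y" "continuous_on (D \<times> E) \<rho>"
      using X_plus_cases[OF assms \<open>\<rho> \<in> X_plus D E\<close>] by blast
    have "continuous_on (D \<times> E) (\<lambda>z. \<rho> z / marginal D \<rho> (snd z))"
    proof (intro continuous_on_divide)
      show "continuous_on (D \<times> E) (\<lambda>z. marginal D \<rho> (snd z))"
        using assms \<delta>
        by (intro continuous_on_compose2[OF continuous_on_marginal[of D E \<rho>] continuous_on_snd])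
          (auto intro: continuous_on_id)
    qed (use \<delta> in force)+
    then show ?thesis
      using DE by (auto simp: mspace_C_space conditional_kernel_def cong: continuous_on_cong)
  qed
  fix \<rho> assume "\<rho> \<in> topspace (mtopology_of (X_plus_metric D E))"
  then have \<rho>: "\<rho> \<in> X_plus D E"
    by (simp add: mspace_X_plus_metric)
  obtain \<delta> where \<delta>: "0 < \<delta>" "\<And>y. y \<in> E \<Longrightarrow> \<delta> \<le> marginal D \<rho> y" "continuous_on (D \<times> E) \<rho>"
    using X_plus_cases[OF assms \<rho>] by blast
  let ?F = "atin (mtopology_of (X_plus_metric D E)) \<rho>"
  \<comment> \<open>The identity is continuous, so it converges to \<open>\<rho>\<close> along the
    filter. Viewed in the submetric, this splits into eventual membership in
    \<open>X_plus D E\<close> and convergence in the ambient \<open>C_space\<close>.\<close>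
  have "limitin (mtopology_of (X_plus_metric D E)) (\<lambda>\<sigma>. \<sigma>) \<rho> ?F"
    using \<rho> by (intro limitin_continuous_map) (auto simp: mspace_X_plus_metric)
  then have X: "\<forall>\<^sub>F \<sigma> in ?F. \<sigma> \<in> X_plus D E" and
    lim: "limitin (mtopology_of (C_space (D \<times> E))) (\<lambda>\<sigma>. \<sigma>) \<rho> ?F"
    by (auto simp: X_plus_metric_def mtopology_of_submetric limitin_subtopology)
  then have unif: "uniform_limit (D \<times> E) (\<lambda>\<sigma>. \<sigma>) \<rho> ?F"
    and "\<forall>\<^sub>F \<sigma> in ?F. continuous_on (D \<times> E) \<sigma>"
    using DE by (auto simp: limitin_C_space mspace_C_space elim: eventually_mono)
  then have "uniform_limit E (marginal D) (marginal D \<rho>) ?F"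
    using uniform_limit_marginal assms \<delta> by fastforce
  then have "uniform_limit (D \<times> E) (\<lambda>\<sigma> z. marginal D \<sigma> (snd z)) (\<lambda>z. marginal D \<rho> (snd z)) ?F"
    by (rule uniform_limit_compose') auto
  then have "uniform_limit (D \<times> E) (\<lambda>\<sigma> z. \<sigma> z / marginal D \<sigma> (snd z))
      (\<lambda>z. \<rho> z / marginal D \<rho> (snd z)) ?F"
  \<comment> \<open>The quotient rule asks for bounds on the limits alone: a bounded numerator
    \<open>\<rho>\<close> and a denominator kept away from zero by the \<open>\<delta>\<close>
    belonging to \<open>\<rho>\<close>.\<close>
  proof (rule uniform_lim_divide[OF unif])
    show "bounded (\<rho> ` (D \<times> E))"
      using DE \<delta> by (intro compact_imp_bounded compact_continuous_image)
    show "\<delta> \<le> norm (marginal D \<rho> (snd z))" if "z \<in> D \<times> E" for z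
      using \<delta>(2)[of "snd z"] that by auto
  qed (fact \<delta>(1))
  then have "uniform_limit (D \<times> E) (conditional_kernel D E) (conditional_kernel D E \<rho>) ?F"
    by (rule uniform_limit_cong'[THEN iffD1, rotated 2]) (auto simp: conditional_kernel_def)
  moreover have "\<forall>\<^sub>F \<sigma> in ?F. conditional_kernel D E \<sigma> \<in> mspace (C_space (D \<times> E))"
    using X by eventually_elim (rule in_C)
  ultimately show "limitin (mtopology_of (C_space (D \<times> E))) (conditional_kernel D E)
      (conditional_kernel D E \<rho>) ?F"
    using DE \<rho> in_C by (simp add: limitin_C_space)
qed

text \<open>Both projections are 1-Lipschitz for the maximum metric. This lets continuity for the
  product topology be transferred to the maximum metric.\<close>

lemma continuous_map_id_max_metric:
  "continuous_map (mtopology_of (max_metric m1 m2))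
    (prod_topology (mtopology_of m1) (mtopology_of m2)) (\<lambda>p. p)"
proof -
  have "Lipschitz_continuous_map (max_metric m1 m2) m1 fst"
    "Lipschitz_continuous_map (max_metric m1 m2) m2 snd"
    unfolding Lipschitz_continuous_map_def by (auto intro!: exI[of _ 1])
  then show ?thesis
    unfolding continuous_map_pairwise
    by (auto simp: o_def dest!: Lipschitz_continuous_imp_continuous_map)
qed

text \<open>A composite of three continuous maps: the identity into the product topology,
  \<open>conditional_kernel\<close> on the first component, and evaluation of the slice at the
  second.\<close>

lemma continuous_map_in_context_conditioning:
  assumes "compact D" "compact E"
  shows "continuous_map
    (mtopology_of (max_metric (X_plus_metric D E) (submetric euclidean_metric E)))
    (mtopology_of (C_space D)) (\<lambda>p. \<lambda>x\<in>D. fst p (x, snd p) / marginal D (fst p) (snd p))"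
proof -
  let ?X = "mtopology_of (max_metric (X_plus_metric D E) (submetric euclidean_metric E))"
  let ?P = "prod_topology (mtopology_of (X_plus_metric D E)) (top_of_set E)"
  have "continuous_map ?X ?P (\<lambda>p. p)"
    using continuous_map_id_max_metric[of "X_plus_metric D E" "submetric euclidean_metric E"]
    by (simp add: mtopology_of_submetric)
  moreover have "continuous_map ?P (prod_topology (mtopology_of (C_space (D \<times> E))) (top_of_set E))
      (\<lambda>p. (conditional_kernel D E (fst p), snd p))"
    using continuous_map_compose[OF continuous_map_fst continuous_map_conditional_kernel[OF assms]]
    by (intro continuous_intros) (simp add: o_def)
  ultimately have "continuous_map ?X (mtopology_of (C_space D))
      ((\<lambda>(f, y). \<lambda>x\<in>D. f (x, y)) \<circ> ((\<lambda>p. (conditional_kernel D E (fst p), snd p)) \<circ> (\<lambda>p. p)))"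
    using continuous_map_slice[OF assms] by (intro continuous_map_compose)
  then show ?thesis
    by (rule continuous_map_eq)
      (auto simp: conditional_kernel_def mspace_X_plus_metric intro!: restrict_ext)
qed

section \<open>Existence and uniqueness of the extensions\<close>

text \<open>Source of uniqueness: the sets \<open>X_delta D E \<delta>\<close> with positive
  \<open>\<delta>\<close> cover \<open>X_plus D E\<close>, so the prescribed restrictions fix every
  value there, and extensionality fixes the rest.\<close>

lemma extensional_eqI:
  assumes "f \<in> extensional A" "g \<in> extensional A" "A = (\<Union>i\<in>I. B i)"
    and "\<And>i. i \<in> I \<Longrightarrow> restrict f (B i) = restrict g (B i)"
  shows "f = g"
proof (rule extensionalityI)
  fix x assume "x \<in> A"
  then obtain i where "i \<in> I" "x \<in> B i"
    unfolding assms(3) by blast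
  then show "f x = g x"
    using fun_cong[OF assms(4)[OF \<open>i \<in> I\<close>], of x] by simp
qed (fact assms(1,2))+

theorem theorem4p6:
  fixes D :: "(real ^ 'm) set" and E :: "(real ^ 'r) set"
  assumes "compact D" and "lipschitz_boundary D"
    and "compact E" and "lipschitz_boundary E"
  shows
    "(\<exists>!G. G \<in> extensional (X_plus D E) \<and>
        continuous_map (mtopology_of (X_plus_metric D E)) (mtopology_of (C_space (D \<times> E))) G \<and>
        (\<forall>\<delta>>0. restrict G (X_delta D E \<delta>) = kernel_conditioning D E \<delta>)) \<and>
     (\<exists>!\<Psi>. \<Psi> \<in> extensional (X_plus D E \<times> E) \<and>
        continuous_map
          (mtopology_of (max_metric (X_plus_metric D E) (submetric euclidean_metric E)))
          (mtopology_of (C_space D)) \<Psi> \<and>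
        (\<forall>\<delta>>0. restrict \<Psi> (X_delta D E \<delta> \<times> E) = in_context_conditioning D E \<delta>))"

proof
  let ?G = "restrict (conditional_kernel D E) (X_plus D E)"
  show "\<exists>!G. G \<in> extensional (X_plus D E) \<and>
        continuous_map (mtopology_of (X_plus_metric D E)) (mtopology_of (C_space (D \<times> E))) G \<and>
        (\<forall>\<delta>>0. restrict G (X_delta D E \<delta>) = kernel_conditioning D E \<delta>)"
  proof (intro ex1I[of _ ?G] conjI allI impI)
    show "continuous_map (mtopology_of (X_plus_metric D E)) (mtopology_of (C_space (D \<times> E))) ?G"
      using continuous_map_conditional_kernel[OF \<open>compact D\<close> \<open>compact E\<close>]
      by (rule continuous_map_eq) (simp add: mspace_X_plus_metric)
    \<comment> \<open>For positive \<open>\<delta>\<close>, \<open>X_delta D E \<delta>\<close> lies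
      in \<open>X_plus D E\<close>, so the outer restriction absorbs the inner one.\<close>
    show G: "restrict ?G (X_delta D E \<delta>) = kernel_conditioning D E \<delta>" if "0 < \<delta>" for \<delta>
      using that unfolding kernel_conditioning_def
      by (intro ext) (auto simp: X_plus_def conditional_kernel_def restrict_def)
    show "G = ?G" if "G \<in> extensional (X_plus D E) \<and>
        continuous_map (mtopology_of (X_plus_metric D E)) (mtopology_of (C_space (D \<times> E))) G \<and>
        (\<forall>\<delta>>0. restrict G (X_delta D E \<delta>) = kernel_conditioning D E \<delta>)" for G
      by (rule extensional_eqI[OF _ _ X_plus_def]) (use that G in auto)
  qed simp
next
  let ?\<Psi> = "\<lambda>p\<in>X_plus D E \<times> E. \<lambda>x\<in>D. fst p (x, snd p) / marginal D (fst p) (snd p)"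
  let ?X = "mtopology_of (max_metric (X_plus_metric D E) (submetric euclidean_metric E))"
  show "\<exists>!\<Psi>. \<Psi> \<in> extensional (X_plus D E \<times> E) \<and>
        continuous_map ?X (mtopology_of (C_space D)) \<Psi> \<and>
        (\<forall>\<delta>>0. restrict \<Psi> (X_delta D E \<delta> \<times> E) = in_context_conditioning D E \<delta>)"
  proof (intro ex1I[of _ ?\<Psi>] conjI allI impI)
    show "continuous_map ?X (mtopology_of (C_space D)) ?\<Psi>"
      using continuous_map_in_context_conditioning[OF \<open>compact D\<close> \<open>compact E\<close>]
      by (rule continuous_map_eq) (simp add: mspace_X_plus_metric mem_Times_iff)
    show \<Psi>: "restrict ?\<Psi> (X_delta D E \<delta> \<times> E) = in_context_conditioning D E \<delta>" if "0 < \<delta>" for \<delta>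
      using that unfolding in_context_conditioning_def
      by (intro ext) (auto simp: X_plus_def restrict_def)
    show "\<Psi> = ?\<Psi>" if "\<Psi> \<in> extensional (X_plus D E \<times> E) \<and>
        continuous_map ?X (mtopology_of (C_space D)) \<Psi> \<and>
        (\<forall>\<delta>>0. restrict \<Psi> (X_delta D E \<delta> \<times> E) = in_context_conditioning D E \<delta>)" for \<Psi>
    \<comment> \<open>The pieces are now \<open>X_delta D E \<delta> \<times> E\<close>; they cover
      because the product with \<open>E\<close> distributes over the union.\<close>
    proof (rule extensional_eqI)
      show "X_plus D E \<times> E = (\<Union>\<delta>\<in>{0<..}. X_delta D E \<delta> \<times> E)"
        by (auto simp: X_plus_def)
    qed (use that \<Psi> in auto)
  qed simp
qed

end
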